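(* Let $g\in\mathfrak F_*$ and assume that $g$ has the strong natural-measure property (SNM). Let $(b_k)_{k\ge0}$ be any sequence of nonnegative integers. Then there is a strictly increasing sequence $\mathbf a=(a_k)_{k\ge0}$ of nonnegative integers such that $a_k\ge b_k$ for every $k$ and $$\frac1n\sum_{k=0}^{n-1}\delta_{g^{a_k}x}\longrightarrow\nu_*\quad\text{weak-star as }n\to\infty$$ for $m$-almost every $x\in I$.
   Context: Strong natural-measure property (SNM) of $g$: for every Borel probability measure $\lambda\ll m$ on $I$, $(g^n)_*\lambda\to\nu_*$ weak-star as $n\to\infty$, where $\nu_*$ is defined below. The class $\mathfrak F_*$. Let $I=[-1,1]$, $I_-=[-1,0]$, $I_+=[0,1]$, and let $m$ be normalized Lebesgue measure on $I$. For a map $g:I\to I$ write $g_-,g_+$ for its branches on $(-1,0)$ and $(0,1)$, and also for their one-sided continuous extensions (so $g_-(0)=1$, $g_+(0)=-1$); the value $g(0)$ is by convention one of these two branch values. Then $g\in\mathfrak F_*$ if the following hold. (A0) $g_-:(-1,0)\to(-1,1)$ and $g_+:(0,1)\to(-1,1)$ are orientation-preserving $C^2$ diffeomorphisms, and the only fixed points of $g$ are $-1$ and $1$. (A1) There are constants $\ell_-,\ell_+,\iota,k_-,k_+,a_-,a_+,b_-,b_+>0$ such that, with $U_{0-}=(-\iota,0]$, $U_{0+}=[0,\iota)$, $U_{-1}=g_+(U_{0+})$, $U_{+1}=g_-(U_{0-})$: $g_-(x)=x+b_-(1+x)^{1+\ell_-}$ on $U_{-1}$ and $g_+(x)=x-b_+(1-x)^{1+\ell_+}$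 on $U_{+1}$; if $k_-\ne1$ then $g_-(x)=1-a_-|x|^{k_-}$ on $U_{0-}$; if $k_+\ne1$ then $g_+(x)=-1+a_+x^{k_+}$ on $U_{0+}$. If $k_-=1$ (resp. $k_+=1$), the corresponding formula is replaced by the requirement that the one-sided derivative satisfies $g'(0-)=a_->1$ (resp. $g'(0+)=a_+>1$), together with monotonicity on the corresponding one-sided neighborhood. (A2) Let $\Delta_0^-=g_-^{-1}((0,1))$, $\Delta_0^+=g_+^{-1}((-1,0))$, and for $n\ge1$ let $\Delta_n^\pm=g_\pm^{-1}(\Delta_{n-1}^\pm)$, $\delta_n^-=g_-^{-1}(\Delta_{n-1}^+)\cap\Delta_0^-$, $\delta_n^+=g_+^{-1}(\Delta_{n-1}^-)\cap\Delta_0^+$. Put $n_\pm=0$ if $\Delta_0^\pm\subset U_{0\pm}$, and otherwise $n_\pm=\min\{n\ge1:\delta_n^\pm\subset U_{0\pm}\}$. There is $\lambda_A>1$ such that, for either sign, $(g^n)'(x)>\lambda_A$ for all $1\le n\le n_\pm$ and $x\in\delta_n^\pm$ (empty requirement if $n_\pm=0$). (Balance) With $\beta^-=\ell_-k_+$, $\beta^+=\ell_+k_-$, one has $\beta^-=\beta^+=:\beta\ge1$. Put $\alpha=1/\beta\in(0,1]$. The measure $\nu_*$. Let $\varphi(u)=\min\{n\ge1:g^nu\in\Delta_0^-\}$ and $G(u)=g^{\varphi(u)}(u)$ be the first-return time and first-return map to $\Delta_0^-$ (defined Lebesgue-a.e. on $\Delta_0^-$). It is known that $G$ is a full-branch Gibbs--Markov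 map with a unique invariant probability $\widehat\mu$ on $\Delta_0^-$ absolutely continuous with respect to (in fact equivalent to) Lebesgue. Let $\tau^+(u)=\#\{1\le r\le\varphi(u):g^ru\in I_+\}$ and $\tau^-(u)=\#\{1\le r\le\varphi(u):g^ru\in I_-\}$. It is known that there are constants $C_+,C_->0$ with $\widehat\mu(\tau^\pm>n)\sim C_\pm n^{-\alpha}$. Put $p_*=C_+/(C_++C_-)$ and $\nu_*=p_*\delta_1+(1-p_* )\delta_{-1}$. *)

theory Defs
  imports "HOL-Probability.Probability"
begin

abbreviation II :: "real set" where "II \<equiv> {-1..1}"
abbreviation II_minus :: "real set" where "II_minus \<equiv> {-1..0}"
abbreviation II_plus :: "real set" where "II_plus \<equiv> {0..1}"

definition borel_II :: "real measure" where
  "borel_II = restrict_space borel II"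

definition leb_II :: "real measure" where
  "leb_II = scale_measure (1/2) (restrict_space lborel II)"

definition weak_star_conv :: "(nat \<Rightarrow> real measure) \<Rightarrow> real measure \<Rightarrow> bool" where
  "weak_star_conv M N \<longleftrightarrow>
     (\<forall>f :: real \<Rightarrow> real. continuous_on II f \<longrightarrow> (\<lambda>n. \<integral>x. f x \<partial>M n) \<longlonglongrightarrow> (\<integral>x. f x \<partial>N))"

text \<open>The measure \<open>\<Sum>k\<in>K. w k \<cdot> \<delta>\<^bsub>p k\<^esub>\<close> on the interval, for finite \<open>K\<close> and points \<open>p k\<close> of the interval.\<close>
definition dirac_sum :: "'k set \<Rightarrow> ('k \<Rightarrow> real) \<Rightarrow> ('k \<Rightarrow> real) \<Rightarrow> real measure" where
  "dirac_sum K w p = distr (point_measure K (\<lambda>k. ennreal (w k))) borel_II p"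

lemma integral_dirac_sum:
  fixes f :: "real \<Rightarrow> real"
  assumes "finite K" "\<And>k. k \<in> K \<Longrightarrow> 0 \<le> w k" "\<And>k. k \<in> K \<Longrightarrow> p k \<in> II" "continuous_on II f"
  shows "(\<integral>x. f x \<partial>dirac_sum K w p) = (\<Sum>k\<in>K. w k * f (p k))"
proof -
  have "f \<in> borel_measurable borel_II"
    using assms(4) unfolding borel_II_def by (rule borel_measurable_continuous_on_restrict)
  moreover have "p \<in> point_measure K (\<lambda>k. ennreal (w k)) \<rightarrow>\<^sub>M borel_II"
    using assms(3) by (auto simp: measurable_point_measure_eq1 borel_II_def space_restrict_space)
  ultimately show ?thesis
    unfolding dirac_sum_def using assms(1,2)
    by (simp add: integral_distr lebesgue_integral_point_measure_finite)
qed

definition C2_on :: "(real \<Rightarrow> real) \<Rightarrow> real set \<Rightarrow> bool" where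
  "C2_on f S \<longleftrightarrow> (\<forall>x\<in>S. f differentiable (at x)) \<and> deriv f C1_differentiable_on S"

definition orient_pres_C2_diffeo :: "(real \<Rightarrow> real) \<Rightarrow> real set \<Rightarrow> real set \<Rightarrow> bool" where
  "orient_pres_C2_diffeo f S T \<longleftrightarrow>
     bij_betw f S T \<and> C2_on f S \<and> C2_on (the_inv_into S f) T \<and> strict_mono_on S f"

text \<open>The branches extended continuously to \<open>0\<close>. At \<open>-1\<close> and \<open>1\<close> the map \<open>g\<close> itself already
  is the continuous extension, because these points are fixed.\<close>
definition br_minus :: "(real \<Rightarrow> real) \<Rightarrow> real \<Rightarrow> real" where "br_minus g = g(0 := 1)"
definition br_plus :: "(real \<Rightarrow> real) \<Rightarrow> real \<Rightarrow> real" where "br_plus g = g(0 := -1)"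

definition cond_A0 :: "(real \<Rightarrow> real) \<Rightarrow> bool" where
  "cond_A0 g \<longleftrightarrow>
     g ` II \<subseteq> II \<and> g 0 \<in> {br_minus g 0, br_plus g 0} \<and>
     orient_pres_C2_diffeo g {-1<..<0} {-1<..<1} \<and>
     orient_pres_C2_diffeo g {0<..<1} {-1<..<1} \<and>
     {x \<in> II. g x = x} = {-1, 1}"

definition U0_minus :: "real \<Rightarrow> real set" where "U0_minus \<iota> = {-\<iota><..0}"
definition U0_plus :: "real \<Rightarrow> real set" where "U0_plus \<iota> = {0..<\<iota>}"

text \<open>\<open>br_plus g ` U0_plus \<iota>\<close> and \<open>br_minus g ` U0_minus \<iota>\<close> are the neighbourhoods of the fixed
  points \<open>-1\<close> and \<open>1\<close>. Nothing has to be said about their being contained in the domains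
  \<open>[-1,0]\<close> and \<open>[0,1]\<close> of the branches: the formulas below cannot hold otherwise, since
  \<open>g x < x\<close> on \<open>(0,1)\<close>, \<open>g x > x\<close> on \<open>(-1,0)\<close>, \<open>g 1 = 1\<close> and \<open>g (-1) = -1\<close>.\<close>
definition cond_A1 ::
  "(real \<Rightarrow> real) \<Rightarrow> real \<Rightarrow> real \<Rightarrow> real \<Rightarrow> real \<Rightarrow> real \<Rightarrow> real \<Rightarrow> real \<Rightarrow> real \<Rightarrow> real \<Rightarrow> bool" where
  "cond_A1 g \<iota> lm lp km kp am ap bm bp \<longleftrightarrow>
     (\<forall>x \<in> br_plus g ` U0_plus \<iota>. br_minus g x = x + bm * (1 + x) powr (1 + lm)) \<and>
     (\<forall>x \<in> br_minus g ` U0_minus \<iota>. br_plus g x = x - bp * (1 - x) powr (1 + lp)) \<and>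
     (if km \<noteq> 1 then \<forall>x \<in> U0_minus \<iota>. br_minus g x = 1 - am * \<bar>x\<bar> powr km
      else (br_minus g has_real_derivative am) (at_left 0) \<and> am > 1 \<and>
           mono_on (U0_minus \<iota>) (br_minus g)) \<and>
     (if kp \<noteq> 1 then \<forall>x \<in> U0_plus \<iota>. br_plus g x = -1 + ap * x powr kp
      else (br_plus g has_real_derivative ap) (at_right 0) \<and> ap > 1 \<and>
           mono_on (U0_plus \<iota>) (br_plus g))"

primrec Delta_minus :: "(real \<Rightarrow> real) \<Rightarrow> nat \<Rightarrow> real set" where
  "Delta_minus g 0 = {x \<in> {-1<..<0}. g x \<in> {0<..<1}}"
| "Delta_minus g (Suc n) = {x \<in> {-1<..<0}. g x \<in> Delta_minus g n}"

primrec Delta_plus :: "(real \<Rightarrow> real) \<Rightarrow> nat \<Rightarrow> real set" where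
  "Delta_plus g 0 = {x \<in> {0<..<1}. g x \<in> {-1<..<0}}"
| "Delta_plus g (Suc n) = {x \<in> {0<..<1}. g x \<in> Delta_plus g n}"

text \<open>Only used for \<open>n \<ge> 1\<close>.\<close>
definition delta_minus :: "(real \<Rightarrow> real) \<Rightarrow> nat \<Rightarrow> real set" where
  "delta_minus g n = {x \<in> {-1<..<0}. g x \<in> Delta_plus g (n - 1)} \<inter> Delta_minus g 0"

definition delta_plus :: "(real \<Rightarrow> real) \<Rightarrow> nat \<Rightarrow> real set" where
  "delta_plus g n = {x \<in> {0<..<1}. g x \<in> Delta_minus g (n - 1)} \<inter> Delta_plus g 0"

definition n_minus :: "(real \<Rightarrow> real) \<Rightarrow> real \<Rightarrow> nat" where
  "n_minus g \<iota> = (if Delta_minus g 0 \<subseteq> U0_minus \<iota> then 0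
                  else LEAST n. n \<ge> 1 \<and> delta_minus g n \<subseteq> U0_minus \<iota>)"

definition n_plus :: "(real \<Rightarrow> real) \<Rightarrow> real \<Rightarrow> nat" where
  "n_plus g \<iota> = (if Delta_plus g 0 \<subseteq> U0_plus \<iota> then 0
                 else LEAST n. n \<ge> 1 \<and> delta_plus g n \<subseteq> U0_plus \<iota>)"

definition cond_A2 :: "(real \<Rightarrow> real) \<Rightarrow> real \<Rightarrow> bool" where
  "cond_A2 g \<iota> \<longleftrightarrow>
     (\<exists>lam>1. (\<forall>n \<in> {1..n_minus g \<iota>}. \<forall>x \<in> delta_minus g n. deriv (g ^^ n) x > lam) \<and>
              (\<forall>n \<in> {1..n_plus g \<iota>}. \<forall>x \<in> delta_plus g n. deriv (g ^^ n) x > lam))"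

text \<open>\<open>F_star \<beta>\<close> consists of the maps in the class whose balanced exponent is \<open>\<beta>\<close>. The exponents
  \<open>\<ell>\<^sub>-, \<ell>\<^sub>+, k\<^sub>-, k\<^sub>+\<close>, and hence \<open>\<beta>\<close>, are determined by \<open>g\<close>, so the class itself is the
  disjoint union of the sets \<open>F_star \<beta>\<close> over all \<open>\<beta> \<ge> 1\<close>.\<close>
definition F_star :: "real \<Rightarrow> (real \<Rightarrow> real) set" where
  "F_star \<beta> = {g. cond_A0 g \<and>
     (\<exists>\<iota> lm lp km kp am ap bm bp.
        \<iota> > 0 \<and> lm > 0 \<and> lp > 0 \<and> km > 0 \<and> kp > 0 \<and> am > 0 \<and> ap > 0 \<and> bm > 0 \<and> bp > 0 \<and>
        cond_A1 g \<iota> lm lp km kp am ap bm bp \<and> cond_A2 g \<iota> \<and>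
        lm * kp = \<beta> \<and> lp * km = \<beta>) \<and> \<beta> \<ge> 1}"

text \<open>The return time and the return map are meaningful only at points that do return, which is
  almost every point of \<open>Delta_minus g 0\<close>.\<close>
definition returns :: "(real \<Rightarrow> real) \<Rightarrow> real \<Rightarrow> bool" where
  "returns g u \<longleftrightarrow> (\<exists>n\<ge>1. (g ^^ n) u \<in> Delta_minus g 0)"

definition ret_time :: "(real \<Rightarrow> real) \<Rightarrow> real \<Rightarrow> nat" where
  "ret_time g u = (LEAST n. n \<ge> 1 \<and> (g ^^ n) u \<in> Delta_minus g 0)"

definition ret_map :: "(real \<Rightarrow> real) \<Rightarrow> real \<Rightarrow> real" where
  "ret_map g u = (g ^^ ret_time g u) u"

definition tau_minus :: "(real \<Rightarrow> real) \<Rightarrow> real \<Rightarrow> nat" where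
  "tau_minus g u = card {r \<in> {1..ret_time g u}. (g ^^ r) u \<in> II_minus}"

definition tau_plus :: "(real \<Rightarrow> real) \<Rightarrow> real \<Rightarrow> nat" where
  "tau_plus g u = card {r \<in> {1..ret_time g u}. (g ^^ r) u \<in> II_plus}"

text \<open>The last conjunct is invariance under the return map; applied to the whole of
  \<open>Delta_minus g 0\<close> it also says that almost every point returns.\<close>
definition acip_ret :: "(real \<Rightarrow> real) \<Rightarrow> real measure \<Rightarrow> bool" where
  "acip_ret g \<mu> \<longleftrightarrow>
     prob_space \<mu> \<and>
     sets \<mu> = sets (restrict_space borel (Delta_minus g 0)) \<and>
     absolutely_continuous (restrict_space lborel (Delta_minus g 0)) \<mu> \<and>
     (\<forall>A \<in> sets \<mu>. emeasure \<mu> {u \<in> Delta_minus g 0. returns g u \<and> ret_map g u \<in> A} = emeasure \<mu> A)"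

definition mu_hat :: "(real \<Rightarrow> real) \<Rightarrow> real measure" where
  "mu_hat g = (THE \<mu>. acip_ret g \<mu>)"

definition C_plus :: "real \<Rightarrow> (real \<Rightarrow> real) \<Rightarrow> real" where
  "C_plus \<alpha> g = (THE C. C > 0 \<and>
     (\<lambda>n. measure (mu_hat g) {u \<in> Delta_minus g 0. tau_plus g u > n})
       \<sim>[at_top] (\<lambda>n. C * real n powr (-\<alpha>)))"

definition C_minus :: "real \<Rightarrow> (real \<Rightarrow> real) \<Rightarrow> real" where
  "C_minus \<alpha> g = (THE C. C > 0 \<and>
     (\<lambda>n. measure (mu_hat g) {u \<in> Delta_minus g 0. tau_minus g u > n})
       \<sim>[at_top] (\<lambda>n. C * real n powr (-\<alpha>)))"

definition p_star :: "real \<Rightarrow> (real \<Rightarrow> real) \<Rightarrow> real" where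
  "p_star \<alpha> g = C_plus \<alpha> g / (C_plus \<alpha> g + C_minus \<alpha> g)"

text \<open>The parameter \<open>\<alpha>\<close> is to be \<open>1 / \<beta>\<close> for \<open>g \<in> F_star \<beta>\<close>.\<close>
definition nu_star :: "real \<Rightarrow> (real \<Rightarrow> real) \<Rightarrow> real measure" where
  "nu_star \<alpha> g = dirac_sum {1, -1} (\<lambda>s. if s = 1 then p_star \<alpha> g else 1 - p_star \<alpha> g) (\<lambda>s. s)"

definition SNM :: "(real \<Rightarrow> real) \<Rightarrow> real measure \<Rightarrow> bool" where
  "SNM g \<nu> \<longleftrightarrow>
     (\<forall>\<rho>. prob_space \<rho> \<and> sets \<rho> = sets borel_II \<and> absolutely_continuous leb_II \<rho> \<longrightarrow>
        weak_star_conv (\<lambda>n. distr \<rho> borel_II (g ^^ n)) \<nu>)"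

definition empirical :: "(real \<Rightarrow> real) \<Rightarrow> (nat \<Rightarrow> nat) \<Rightarrow> real \<Rightarrow> nat \<Rightarrow> real measure" where
  "empirical g a x n = dirac_sum {..<n} (\<lambda>_. 1 / real n) (\<lambda>k. (g ^^ a k) x)"

end

theory Submission
  imports Defs "HOL-Library.Discrete_Functions"
begin

text \<open>
  Testing SNM against bounded densities shows that the centred moments
  \<open>X j n = (g\<^sup>n)\<^sup>j - \<integral>x\<^sup>j d\<nu>\<close> tend to \<open>0\<close> weakly: \<open>\<integral>h \<cdot> X j n dm \<longlonglongrightarrow> 0\<close> for
  every bounded \<open>h\<close>. Hence \<open>a k\<close> can be chosen so late that \<open>X j (a k)\<close> is nearly
  orthogonal to all \<open>X j (a i)\<close> with \<open>i < k\<close>, for all \<open>j \<le> k\<close>. The second moment of the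
  \<open>n\<close>-th partial sum is then \<open>O(n)\<close>, so the averages converge almost surely along the squares,
  and, by boundedness, along all \<open>n\<close>. Polynomials being dense, all continuous test functions
  are covered at once.
\<close>

section \<open>Averages and second moments\<close>

text \<open>If \<open>q\<^sup>2 \<le> n < (Suc q)\<^sup>2\<close>, then at most \<open>2 * q\<close>
  terms lie beyond the last square. Each is at most \<open>B\<close> in absolute value, so after
  division by \<open>q\<^sup>2\<close> they contribute at most \<open>2 * B / q\<close>, which
  vanishes as \<open>n\<close> grows.\<close>

lemma Cesaro_from_squares:
  fixes y :: "nat \<Rightarrow> real"
  assumes bd: "\<And>k. \<bar>y k\<bar> \<le> B"
    and sq: "(\<lambda>n. (\<Sum>k<n\<^sup>2. y k) / real (n\<^sup>2)) \<longlonglongrightarrow> 0"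
  shows "(\<lambda>n. (\<Sum>k<n. y k) / real n) \<longlonglongrightarrow> 0"
proof -
  define r where "r = (floor_sqrt :: nat \<Rightarrow> nat)"
  have B: "0 \<le> B" using bd[of 0] by linarith
  have r: "filterlim r at_top sequentially"
    unfolding filterlim_at_top
  proof
    fix Z
    show "eventually (\<lambda>n. Z \<le> r n) sequentially"
      using eventually_ge_at_top[of "Z\<^sup>2"]
      by eventually_elim (simp add: r_def le_floor_sqrt_iff)
  qed
  \<comment> \<open>The majorant for the comparison: the average at the last square plus the cost of
    the gap after it.\<close>
  have sq': "(\<lambda>n. \<bar>(\<Sum>k<(r n)\<^sup>2. y k) / real ((r n)\<^sup>2)\<bar> + 2 * B / real (r n)) \<longlonglongrightarrow> \<bar>0\<bar> + 0"
  proof (intro tendsto_add tendsto_rabs)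
    show "(\<lambda>n. (\<Sum>k<(r n)\<^sup>2. y k) / real ((r n)\<^sup>2)) \<longlonglongrightarrow> 0"
      using filterlim_compose[OF sq r] .
    show "(\<lambda>n. 2 * B / real (r n)) \<longlonglongrightarrow> 0"
      using filterlim_compose[OF lim_const_over_n[of "2 * B"] r] by simp
  qed
  have "eventually (\<lambda>n. norm ((\<Sum>k<n. y k) / real n) \<le>
      \<bar>(\<Sum>k<(r n)\<^sup>2. y k) / real ((r n)\<^sup>2)\<bar> + 2 * B / real (r n)) sequentially"
    using eventually_ge_at_top[of 1]
  proof eventually_elim
    fix n :: nat assume n: "1 \<le> n"
    define q where "q = r n"
    have q: "q\<^sup>2 \<le> n" "n < (Suc q)\<^sup>2" "1 \<le> q"
      using n by (simp_all add: q_def r_def Suc_floor_sqrt_power2_gt le_floor_sqrt_iff)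
    have "real (q\<^sup>2) > 0" using q(3) by simp
    have eq: "(\<Sum>k<n. y k) = (\<Sum>k<q\<^sup>2. y k) + (\<Sum>k=q\<^sup>2..<n. y k)"
      using q(1) by (metis atLeast0LessThan le0 sum.atLeastLessThan_concat)
    have "\<bar>\<Sum>k=q\<^sup>2..<n. y k\<bar> \<le> (\<Sum>k=q\<^sup>2..<n. B)"
      by (rule order_trans[OF sum_abs sum_mono]) (rule bd)
    also have "\<dots> = real (n - q\<^sup>2) * B" by simp
    also have "\<dots> \<le> real (2 * q) * B"
    proof (rule mult_right_mono[OF _ B])
      have "(Suc q)\<^sup>2 = q\<^sup>2 + 2 * q + 1" by (simp add: power2_eq_square)
      then have "n - q\<^sup>2 \<le> 2 * q" using q(2) by linarith
      then show "real (n - q\<^sup>2) \<le> real (2 * q)" by (simp only: of_nat_le_iff)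
    qed
    finally have "\<bar>\<Sum>k<n. y k\<bar> \<le> \<bar>\<Sum>k<q\<^sup>2. y k\<bar> + 2 * q * B"
      unfolding eq by simp
    \<comment> \<open>Since \<open>q\<^sup>2 \<le> n\<close>, the denominator may be lowered to
      \<open>q\<^sup>2\<close>, which produces the average along squares.\<close>
    then have "\<bar>\<Sum>k<n. y k\<bar> / real n \<le> (\<bar>\<Sum>k<q\<^sup>2. y k\<bar> + 2 * q * B) / real (q\<^sup>2)"
      using q B \<open>real (q\<^sup>2) > 0\<close> by (intro frac_le) (auto simp del: of_nat_power)
    also have "\<dots> = \<bar>\<Sum>k<q\<^sup>2. y k\<bar> / real (q\<^sup>2) + 2 * B / real q"
      using q(3) by (simp add: field_simps power2_eq_square)
    finally show "norm ((\<Sum>k<n. y k) / real n) \<le>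
      \<bar>(\<Sum>k<(r n)\<^sup>2. y k) / real ((r n)\<^sup>2)\<bar> + 2 * B / real (r n)"
      by (simp add: q_def)
  qed
  then show ?thesis
    by (rule Lim_null_comparison) (use sq' in simp)
qed

text \<open>The average of \<open>n\<close> terms has mean square at most \<open>D / n\<close>,
  which is not summable; along squares the bound becomes \<open>D / n\<^sup>2\<close>, which is. The
  sum of the squared averages is then finite almost everywhere, so its terms tend to 0, and
  boundedness fills the gaps between squares.\<close>

lemma (in prob_space) AE_Cesaro_of_second_moment:
  fixes Y :: "nat \<Rightarrow> 'a \<Rightarrow> real"
  assumes [measurable]: "\<And>k. Y k \<in> borel_measurable M"
    and bd: "\<And>k x. x \<in> space M \<Longrightarrow> \<bar>Y k x\<bar> \<le> B"
    and second: "\<And>n. expectation (\<lambda>x. (\<Sum>k<n. Y k x)\<^sup>2) \<le> D * real n"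
  shows "AE x in M. (\<lambda>n. (\<Sum>k<n. Y k x) / real n) \<longlonglongrightarrow> 0"
proof -
  define Z where "Z n x = ((\<Sum>k<n\<^sup>2. Y k x) / real (n\<^sup>2))\<^sup>2" for n x
  have [measurable]: "Z n \<in> borel_measurable M" for n unfolding Z_def by measurable
  have int: "integrable M (\<lambda>x. (\<Sum>k<n. Y k x)\<^sup>2)" for n
  proof (rule integrable_const_bound[of _ "(real n * B)\<^sup>2"])
    show "AE x in M. norm ((\<Sum>k<n. Y k x)\<^sup>2) \<le> (real n * B)\<^sup>2"
    proof (rule AE_I2)
      fix x assume "x \<in> space M"
      then have "\<bar>\<Sum>k<n. Y k x\<bar> \<le> (\<Sum>k<n. B)"
        by (intro order_trans[OF sum_abs sum_mono]) (rule bd)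
      then show "norm ((\<Sum>k<n. Y k x)\<^sup>2) \<le> (real n * B)\<^sup>2"
        by (simp add: abs_le_square_iff[symmetric])
    qed
  qed measurable
  have Zint: "integrable M (Z n)" for n
    using int[of "n\<^sup>2"] by (simp add: Z_def[abs_def] power_divide)
  \<comment> \<open>The absolute value is taken because \<open>D\<close> comes without a sign. At
    \<open>n = 0\<close> both sides are 0, as division by zero yields 0.\<close>
  have Zle: "expectation (Z n) \<le> \<bar>D\<bar> * (1 / real n ^ 2)" for n
  proof (cases "n = 0")
    case False
    have "expectation (Z n) = expectation (\<lambda>x. (\<Sum>k<n\<^sup>2. Y k x)\<^sup>2) / (real (n\<^sup>2))\<^sup>2"
      by (simp add: Z_def[abs_def] power_divide)
    also have "\<dots> \<le> \<bar>D\<bar> * real (n\<^sup>2) / (real (n\<^sup>2))\<^sup>2"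
      by (intro divide_right_mono order_trans[OF second] mult_right_mono) auto
    also have "\<dots> = \<bar>D\<bar> * (1 / real n ^ 2)"
      using False by (simp add: power2_eq_square)
    finally show ?thesis .
  qed (simp add: Z_def[abs_def])
  have sm: "summable (\<lambda>n. \<bar>D\<bar> * (1 / real n ^ 2))"
    using inverse_power_summable[of 2, where 'a = real]
    by (intro summable_mult) (simp add: inverse_eq_divide power_divide)
  \<comment> \<open>Sum and integral are exchanged in \<open>ennreal\<close>, where a finite
    integral forces the integrand to be finite almost everywhere.\<close>
  have "(\<integral>\<^sup>+x. (\<Sum>n. ennreal (Z n x)) \<partial>M) = (\<Sum>n. \<integral>\<^sup>+x. ennreal (Z n x) \<partial>M)"
    by (rule nn_integral_suminf) measurable
  also have "\<dots> = (\<Sum>n. ennreal (expectation (Z n)))"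
    using Zint by (subst nn_integral_eq_integral) (auto simp: Z_def)
  also have "\<dots> \<le> (\<Sum>n. ennreal (\<bar>D\<bar> * (1 / real n ^ 2)))"
    by (intro suminf_le ennreal_leI Zle) auto
  also have "\<dots> < \<infinity>"
    using sm by (subst suminf_ennreal2) auto
  finally have "AE x in M. (\<Sum>n. ennreal (Z n x)) \<noteq> \<infinity>"
    by (intro nn_integral_PInf_AE) auto
  with AE_space show ?thesis
  proof eventually_elim
    fix x assume x: "x \<in> space M" and "(\<Sum>n. ennreal (Z n x)) \<noteq> \<infinity>"
    then have "summable (\<lambda>n. Z n x)"
      by (intro summable_suminf_not_top) (auto simp: Z_def)
    then have "(\<lambda>n. Z n x) \<longlonglongrightarrow> 0" by (rule summable_LIMSEQ_zero)
    then have "(\<lambda>n. sqrt (Z n x)) \<longlonglongrightarrow> sqrt 0" by (rule tendsto_real_sqrt)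
    then have "(\<lambda>n. \<bar>(\<Sum>k<n\<^sup>2. Y k x) / real (n\<^sup>2)\<bar>) \<longlonglongrightarrow> 0"
      by (simp add: Z_def)
    then have "(\<lambda>n. (\<Sum>k<n\<^sup>2. Y k x) / real (n\<^sup>2)) \<longlonglongrightarrow> 0"
      by (rule tendsto_rabs_zero_cancel)
    then show "(\<lambda>n. (\<Sum>k<n. Y k x) / real n) \<longlonglongrightarrow> 0"
      using bd[OF x] by (intro Cesaro_from_squares[of _ B])
  qed
qed

text \<open>Expand the square one summand at a time. For \<open>n \<ge> j\<close> the
  \<open>n\<close> new cross terms are each at most \<open>1 / (n + 1)\<close> and add up to at most
  1. For \<open>n < j\<close> there are fewer than \<open>j\<close> of them, each at most
  \<open>B\<^sup>2\<close>. A late start of the correlation bound thus affects only the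
  constant.\<close>

lemma (in prob_space) second_moment_le:
  fixes Y :: "nat \<Rightarrow> 'a \<Rightarrow> real"
  assumes [measurable]: "\<And>k. Y k \<in> borel_measurable M"
    and bd: "\<And>k x. x \<in> space M \<Longrightarrow> \<bar>Y k x\<bar> \<le> B" and B: "0 \<le> B"
    and cor: "\<And>i k. i < k \<Longrightarrow> j \<le> k \<Longrightarrow> \<bar>expectation (\<lambda>x. Y i x * Y k x)\<bar> \<le> 1 / real (Suc k)"
  shows "expectation (\<lambda>x. (\<Sum>k<n. Y k x)\<^sup>2) \<le> (2 + 2 * real j * B\<^sup>2 + B\<^sup>2) * real n"
proof -
  have prod_bd: "\<bar>Y i x * Y k x\<bar> \<le> B\<^sup>2" if "x \<in> space M" for i k x
    using that bd B unfolding abs_mult power2_eq_square by (intro mult_mono) auto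
  have int: "integrable M (\<lambda>x. Y i x * Y k x)" for i k
    by (rule integrable_const_bound[of _ "B\<^sup>2"]) (auto simp: prod_bd)
  have int2: "integrable M (\<lambda>x. (\<Sum>k<n. Y k x)\<^sup>2)" for n
    by (simp add: power2_eq_square sum_product int)
  have E_bd: "\<bar>expectation (\<lambda>x. Y i x * Y k x)\<bar> \<le> B\<^sup>2" for i k
  proof -
    have "\<bar>expectation (\<lambda>x. Y i x * Y k x)\<bar> \<le> expectation (\<lambda>x. \<bar>Y i x * Y k x\<bar>)"
      using integral_norm_bound[of M "\<lambda>x. Y i x * Y k x"] by simp
    also have "\<dots> \<le> expectation (\<lambda>x. B\<^sup>2)"
      by (intro integral_mono integrable_abs int prod_bd) auto
    finally show ?thesis by (simp add: prob_space)
  qed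
  have cross: "\<bar>\<Sum>i<n. expectation (\<lambda>x. Y i x * Y n x)\<bar> \<le> 1 + real j * B\<^sup>2" for n
  proof (cases "j \<le> n")
    case True
    have "\<bar>\<Sum>i<n. expectation (\<lambda>x. Y i x * Y n x)\<bar> \<le> (\<Sum>i<n. 1 / real (Suc n))"
      using True by (intro order_trans[OF sum_abs sum_mono] cor) auto
    also have "\<dots> \<le> 1" by simp
    also have "\<dots> \<le> 1 + real j * B\<^sup>2" by simp
    finally show ?thesis .
  next
    case False
    have "\<bar>\<Sum>i<n. expectation (\<lambda>x. Y i x * Y n x)\<bar> \<le> (\<Sum>i<n. B\<^sup>2)"
      by (intro order_trans[OF sum_abs sum_mono] E_bd)
    also have "\<dots> \<le> real j * B\<^sup>2" using False by (auto intro!: mult_right_mono)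
    finally show ?thesis by simp
  qed
  show ?thesis
  proof (induction n)
    case (Suc n)
    have "(\<lambda>x. (\<Sum>k<Suc n. Y k x)\<^sup>2) =
        (\<lambda>x. (\<Sum>k<n. Y k x)\<^sup>2 + 2 * (\<Sum>i<n. Y i x * Y n x) + Y n x * Y n x)"
      by (simp add: fun_eq_iff power2_eq_square algebra_simps sum_distrib_left)
    then have "expectation (\<lambda>x. (\<Sum>k<Suc n. Y k x)\<^sup>2) = expectation (\<lambda>x. (\<Sum>k<n. Y k x)\<^sup>2)
        + 2 * (\<Sum>i<n. expectation (\<lambda>x. Y i x * Y n x)) + expectation (\<lambda>x. Y n x * Y n x)"
      by (simp only:) (simp add: int int2)
    \<comment> \<open>The increment \<open>2 * (1 + real j * B\<^sup>2) + B\<^sup>2\<close> is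
      exactly the coefficient of \<open>n\<close> in the claim.\<close>
    also have "\<dots> \<le> (2 + 2 * real j * B\<^sup>2 + B\<^sup>2) * real n + 2 * (1 + real j * B\<^sup>2) + B\<^sup>2"
      by (intro add_mono mult_left_mono Suc.IH abs_le_D1[OF cross] abs_le_D1[OF E_bd]) simp
    finally show ?case by (simp add: algebra_simps)
  qed simp
qed

section \<open>Selection of the sparse sequence\<close>

text \<open>A diagonal choice: stage \<open>k\<close> treats only the families
  \<open>j \<le> k\<close> and the earlier indices \<open>i < k\<close>, hence finitely many
  requirements, each satisfied by all large \<open>n\<close>. A fixed family \<open>j\<close> is
  controlled from stage \<open>j\<close> on, which is the form of hypothesis in
  \<open>second_moment_le\<close>.\<close>

lemma (in prob_space) sparse_Cesaro_of_weak_null: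
  fixes X :: "nat \<Rightarrow> nat \<Rightarrow> 'a \<Rightarrow> real" and b :: "nat \<Rightarrow> nat"
  assumes X [measurable]: "\<And>j n. X j n \<in> borel_measurable M"
    and bd: "\<And>j n x. x \<in> space M \<Longrightarrow> \<bar>X j n x\<bar> \<le> B" and B: "0 \<le> B"
    and null: "\<And>j h. h \<in> borel_measurable M \<Longrightarrow> (\<And>x. x \<in> space M \<Longrightarrow> \<bar>h x\<bar> \<le> B) \<Longrightarrow>
      (\<lambda>n. expectation (\<lambda>x. h x * X j n x)) \<longlonglongrightarrow> 0"
  obtains a where "strict_mono a" "\<And>k. b k \<le> a k"
    "AE x in M. \<forall>j. (\<lambda>n. (\<Sum>k<n. X j (a k) x) / real n) \<longlonglongrightarrow> 0"
proof -
  define P where "P a k n \<longleftrightarrow> b k \<le> n \<and> (\<forall>i<k. a i < n \<and>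
      (\<forall>j\<le>k. \<bar>expectation (\<lambda>x. X j (a i) x * X j n x)\<bar> \<le> 1 / real (Suc k)))"
    for a :: "nat \<Rightarrow> nat" and k n
  \<comment> \<open>Course-of-values recursion: \<open>P a k n\<close> reads \<open>a\<close> only
    below \<open>k\<close>, and every choice of earlier values admits a suitable
    \<open>n\<close>.\<close>
  have "\<exists>a. \<forall>k. P a k (a k)"
  proof (rule dependent_wellorder_choice)
    fix n k and a a' :: "nat \<Rightarrow> nat"
    assume "\<And>i. i < k \<Longrightarrow> a i = a' i"
    then show "P a k n = P a' k n" by (auto simp: P_def)
  next
    fix k and a :: "nat \<Rightarrow> nat"
    \<comment> \<open>Bounded quantifiers over finite sets let the eventual statements be
      intersected. The weak limit \<open>null\<close> is applied with the already chosen
      \<open>X j (a i)\<close> as test function \<open>h\<close>.\<close>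
    have "eventually (\<lambda>n. b k \<le> n \<and> (\<forall>i\<in>{..<k}. a i < n \<and>
      (\<forall>j\<in>{..k}. \<bar>expectation (\<lambda>x. X j (a i) x * X j n x)\<bar> \<le> 1 / real (Suc k)))) sequentially"
    proof (intro eventually_conj eventually_ball_finite ballI)
      fix i j
      have "(\<lambda>n. expectation (\<lambda>x. X j (a i) x * X j n x)) \<longlonglongrightarrow> 0"
        by (rule null) (auto simp: bd)
      then have "eventually (\<lambda>n. dist (expectation (\<lambda>x. X j (a i) x * X j n x)) 0 < 1 / real (Suc k)) sequentially"
        by (rule tendstoD) simp
      then show "eventually (\<lambda>n. \<bar>expectation (\<lambda>x. X j (a i) x * X j n x)\<bar> \<le> 1 / real (Suc k)) sequentially"
        by eventually_elim simp
    qed (simp_all add: eventually_ge_at_top eventually_gt_at_top)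
    then obtain n where "b k \<le> n \<and> (\<forall>i\<in>{..<k}. a i < n \<and>
      (\<forall>j\<in>{..k}. \<bar>expectation (\<lambda>x. X j (a i) x * X j n x)\<bar> \<le> 1 / real (Suc k)))"
      using eventually_happens'[OF sequentially_bot] by blast
    then show "\<exists>n. P a k n" by (auto simp: P_def)
  qed
  then obtain a where a: "\<And>k. P a k (a k)" by blast
  show thesis
  proof
    show "strict_mono a" using a by (auto simp: P_def strict_mono_def)
    show "b k \<le> a k" for k using a[of k] by (simp add: P_def)
    \<comment> \<open>The second-moment constant depends on \<open>j\<close>; this is harmless
      because each \<open>j\<close> is settled separately before the countable intersection.\<close>
    have "AE x in M. (\<lambda>n. (\<Sum>k<n. X j (a k) x) / real n) \<longlonglongrightarrow> 0" for j
    proof (rule AE_Cesaro_of_second_moment[OF X bd second_moment_le[OF X bd B]])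
      show "\<bar>expectation (\<lambda>x. X j (a i) x * X j (a k) x)\<bar> \<le> 1 / real (Suc k)"
        if "i < k" "j \<le> k" for i k
        using a[of k] that by (auto simp: P_def)
    qed
    then show "AE x in M. \<forall>j. (\<lambda>n. (\<Sum>k<n. X j (a k) x) / real n) \<longlonglongrightarrow> 0"
      by (simp add: AE_all_countable)
  qed
qed

section \<open>Continuous functions and moments on the interval\<close>

lemma space_borel_II: "space borel_II = II"
  by (simp add: borel_II_def space_restrict_space)

lemma integrable_continuous_II:
  fixes f :: "real \<Rightarrow> real"
  assumes M: "prob_space M" "sets M = sets borel_II" and f: "continuous_on II f"
  shows "integrable M f"
proof -
  interpret prob_space M by fact
  have [simp]: "space M = II" using sets_eq_imp_space_eq[OF M(2)] space_borel_II by simp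
  have "f \<in> borel_measurable M"
    using f unfolding measurable_cong_sets[OF M(2) refl] borel_II_def
    by (rule borel_measurable_continuous_on_restrict)
  moreover have "bounded (f ` II)"
    using f by (intro compact_imp_bounded compact_continuous_image) auto
  then obtain C where "\<And>x. x \<in> II \<Longrightarrow> norm (f x) \<le> C"
    unfolding bounded_iff by blast
  ultimately show ?thesis
    by (intro integrable_const_bound[of _ C] AE_I2) auto
qed

lemma integral_diff_le_II:
  fixes f p :: "real \<Rightarrow> real"
  assumes M: "prob_space M" "sets M = sets borel_II"
    and "continuous_on II f" "continuous_on II p" and fp: "\<And>x. x \<in> II \<Longrightarrow> \<bar>f x - p x\<bar> \<le> e"
  shows "\<bar>(\<integral>x. f x \<partial>M) - (\<integral>x. p x \<partial>M)\<bar> \<le> e"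
proof -
  interpret prob_space M by fact
  have [simp]: "space M = II" using sets_eq_imp_space_eq[OF M(2)] space_borel_II by simp
  have "prob II = 1" using prob_space by simp
  have int: "integrable M f" "integrable M p"
    using assms by (auto intro: integrable_continuous_II)
  have "\<bar>(\<integral>x. f x \<partial>M) - (\<integral>x. p x \<partial>M)\<bar> = \<bar>\<integral>x. f x - p x \<partial>M\<bar>"
    using int by simp
  also have "\<dots> \<le> (\<integral>x. \<bar>f x - p x\<bar> \<partial>M)"
    using integral_norm_bound[of M "\<lambda>x. f x - p x"] by simp
  also have "\<dots> \<le> (\<integral>x. e \<partial>M)"
    using int fp by (intro integral_mono) auto
  finally show ?thesis using \<open>prob II = 1\<close> by simp
qed

text \<open>Approximate \<open>f\<close> uniformly by a polynomial and split the error into three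
  parts. Two sequences of probability measures are compared, rather than one sequence with its
  limit: \<open>\<nu>\<close> is to enter only through the limits of integrals against the
  pushforwards of Lebesgue measure.\<close>

lemma weak_star_diff_of_moments:
  fixes f :: "real \<Rightarrow> real"
  assumes M: "\<And>n. prob_space (M n)" "\<And>n. sets (M n) = sets borel_II"
    and N: "\<And>n. prob_space (N n)" "\<And>n. sets (N n) = sets borel_II"
    and mom: "\<And>j. (\<lambda>n. (\<integral>x. x ^ j \<partial>M n) - (\<integral>x. x ^ j \<partial>N n)) \<longlonglongrightarrow> 0"
    and f: "continuous_on II f"
  shows "(\<lambda>n. (\<integral>x. f x \<partial>M n) - (\<integral>x. f x \<partial>N n)) \<longlonglongrightarrow> 0"
proof (rule tendstoI)
  fix e :: real assume e: "0 < e"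
  obtain p where "real_polynomial_function p" and "\<And>x. x \<in> II \<Longrightarrow> \<bar>f x - p x\<bar> < e / 3"
    by (rule Stone_Weierstrass_real_polynomial_function[OF compact_Icc f, of "e / 3"]) (use e in auto)
  then have poly: "real_polynomial_function p" and fp: "\<And>x. x \<in> II \<Longrightarrow> \<bar>f x - p x\<bar> \<le> e / 3"
    by (auto intro: less_imp_le)
  obtain c d where p: "p = (\<lambda>x. \<Sum>i\<le>d. c i * x ^ i)"
    using poly real_polynomial_function_iff_sum by blast
  have pc: "continuous_on II p" unfolding p by (intro continuous_intros)
  \<comment> \<open>An integral of \<open>p\<close> is a finite combination of moments, so
    \<open>mom\<close> applies termwise.\<close>
  have pint: "(\<integral>x. p x \<partial>L) = (\<Sum>i\<le>d. c i * (\<integral>x. x ^ i \<partial>L))"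
    if "prob_space L" "sets L = sets borel_II" for L
  proof -
    have "integrable L (\<lambda>x. x ^ i)" for i
      by (intro integrable_continuous_II that continuous_intros)
    then show ?thesis by (simp add: p)
  qed
  have "(\<lambda>n. \<Sum>i\<le>d. c i * ((\<integral>x. x ^ i \<partial>M n) - (\<integral>x. x ^ i \<partial>N n))) \<longlonglongrightarrow> (\<Sum>i\<le>d. c i * 0)"
    by (intro tendsto_sum tendsto_mult tendsto_const mom)
  then have "(\<lambda>n. (\<integral>x. p x \<partial>M n) - (\<integral>x. p x \<partial>N n)) \<longlonglongrightarrow> 0"
    by (simp add: pint M N sum_subtractf right_diff_distrib)
  then have "eventually (\<lambda>n. dist ((\<integral>x. p x \<partial>M n) - (\<integral>x. p x \<partial>N n)) 0 < e / 3) sequentially"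
    by (rule tendstoD) (use e in simp)
  then show "eventually (\<lambda>n. dist ((\<integral>x. f x \<partial>M n) - (\<integral>x. f x \<partial>N n)) 0 < e) sequentially"
  proof eventually_elim
    case (elim n)
    then show ?case
      using integral_diff_le_II[OF M f pc fp, of n] integral_diff_le_II[OF N f pc fp, of n]
      unfolding dist_real_def by linarith
  qed
qed

section \<open>Normalized Lebesgue measure and measurability of the iterates\<close>

lemma prob_space_leb_II: "prob_space leb_II"
proof
  have "emeasure leb_II (space leb_II) = 1 / 2 * emeasure lborel II"
    by (simp add: leb_II_def space_scale_measure space_restrict_space emeasure_restrict_space)
  also have "\<dots> = 1" by (simp add: ennreal_divide_times)
  finally show "emeasure leb_II (space leb_II) = 1" .
qed

lemma sets_leb_II: "sets leb_II = sets borel_II"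
  by (simp add: leb_II_def borel_II_def sets_restrict_space)

text \<open>The interval splits into the two open branch domains, where \<open>g\<close> is
  differentiable and hence continuous, and the three points -1, 0 and 1, where continuity of the
  restriction is trivial.\<close>

lemma measurable_cond_A0:
  assumes "cond_A0 g"
  shows "g \<in> borel_II \<rightarrow>\<^sub>M borel_II"
proof -
  define C :: "real set set" where "C = {{-1<..<0}, {0<..<1}, {-1}, {0}, {1}}"
  have "continuous_on {-1<..<0} g" "continuous_on {0<..<1} g"
    using assms unfolding cond_A0_def orient_pres_C2_diffeo_def C2_on_def
    by (auto intro!: continuous_at_imp_continuous_on differentiable_imp_continuous_within)
  then have cont: "continuous_on \<Omega> g" if "\<Omega> \<in> C" for \<Omega>
    using that by (auto simp: C_def)
  have "g \<in> borel_measurable borel_II"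
  proof (rule measurable_piecewise_restrict[of C])
    show "space borel_II \<subseteq> \<Union>C" by (auto simp: C_def space_borel_II)
    fix \<Omega> assume "\<Omega> \<in> C"
    then have sub: "\<Omega> \<subseteq> II" and meas: "\<Omega> \<in> sets borel" by (auto simp: C_def)
    then show "\<Omega> \<inter> space borel_II \<in> sets borel_II"
      by (auto simp: borel_II_def sets_restrict_space space_restrict_space)
    show "g \<in> borel_measurable (restrict_space borel_II \<Omega>)"
      using borel_measurable_continuous_on_restrict[OF cont[OF \<open>\<Omega> \<in> C\<close>]] sub meas
      by (simp add: borel_II_def restrict_restrict_space Int_absorb1)
  qed (simp add: C_def)
  moreover have "g \<in> space borel_II \<rightarrow> II"
    using assms by (auto simp: cond_A0_def space_borel_II)
  ultimately show ?thesis
    unfolding borel_II_def by (intro measurable_restrict_space2)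
qed

lemma measurable_funpow:
  assumes "g \<in> M \<rightarrow>\<^sub>M M"
  shows "g ^^ n \<in> M \<rightarrow>\<^sub>M M"
proof (induction n)
  case 0
  then show ?case by (simp add: id_def)
next
  case (Suc n)
  then show ?case using assms by (auto intro: measurable_comp)
qed

section \<open>Weak decorrelation from the natural-measure property\<close>

text \<open>Dividing \<open>w\<close> by its integral \<open>W\<close> gives a probability density,
  to which SNM applies. The lower bound on \<open>w\<close> forces \<open>W \<ge> 1\<close>, so the
  normalization is legitimate. The integrability claim serves later to split the integral of a
  difference.\<close>

lemma SNM_weighted:
  fixes f w :: "real \<Rightarrow> real"
  assumes SNM: "SNM g \<nu>" and g: "g \<in> borel_II \<rightarrow>\<^sub>M borel_II" and f: "continuous_on II f"
    and w [measurable]: "w \<in> borel_measurable leb_II"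
    and w1: "\<And>x. x \<in> II \<Longrightarrow> 1 \<le> w x" and wK: "\<And>x. x \<in> II \<Longrightarrow> w x \<le> K"
  shows "integrable leb_II (\<lambda>x. w x * (f ((g ^^ n) x) - (\<integral>x. f x \<partial>\<nu>)))" (is ?int)
    and "(\<lambda>n. \<integral>x. w x * (f ((g ^^ n) x) - (\<integral>x. f x \<partial>\<nu>)) \<partial>leb_II) \<longlonglongrightarrow> 0" (is ?lim)
proof -
  interpret prob_space leb_II by (rule prob_space_leb_II)
  have [simp]: "space leb_II = II"
    using sets_eq_imp_space_eq[OF sets_leb_II] space_borel_II by simp
  have gn_II: "g ^^ n \<in> borel_II \<rightarrow>\<^sub>M borel_II" for n
    using g by (rule measurable_funpow)
  have gn [measurable]: "g ^^ n \<in> leb_II \<rightarrow>\<^sub>M borel_II" for n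
    using gn_II unfolding measurable_cong_sets[OF sets_leb_II refl] .
  have fm [measurable]: "f \<in> borel_measurable borel_II"
    using f unfolding borel_II_def by (rule borel_measurable_continuous_on_restrict)
  have "integrable (distr leb_II borel_II (g ^^ n)) f" for n
    using f by (intro integrable_continuous_II prob_space_distr gn) auto
  then have intF: "integrable leb_II (\<lambda>x. f ((g ^^ n) x))" for n
    by (subst (asm) integrable_distr_eq) (auto intro: gn)
  have intw: "integrable leb_II w"
    using w1 wK by (intro integrable_const_bound[of _ K] AE_I2) (auto, force)
  have intwF: "integrable leb_II (\<lambda>x. w x * f ((g ^^ n) x))" for n
  proof (rule Bochner_Integration.integrable_bound[OF integrable_mult_right[OF intF[of n], of K]])
    show "AE x in leb_II. norm (w x * f ((g ^^ n) x)) \<le> norm (K * f ((g ^^ n) x))"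
    proof (rule AE_I2)
      fix x assume "x \<in> space leb_II"
      then have "\<bar>w x\<bar> \<le> \<bar>K\<bar>" using w1[of x] wK[of x] by simp
      then show "norm (w x * f ((g ^^ n) x)) \<le> norm (K * f ((g ^^ n) x))"
        by (simp add: abs_mult mult_right_mono)
    qed
  qed measurable
  have intw': "integrable leb_II (\<lambda>x. w x * (\<integral>x. f x \<partial>\<nu>))"
    using intw by simp
  show ?int using intwF intw' by (simp add: right_diff_distrib)
  define W where "W = expectation w"
  have "expectation (\<lambda>x. 1) \<le> W"
    unfolding W_def using intw w1 by (intro integral_mono) auto
  then have W: "1 \<le> W" using prob_space by simp
  define \<rho> where "\<rho> = density leb_II (\<lambda>x. ennreal (w x / W))"
  have pos: "0 \<le> w x / W" if "x \<in> II" for x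
    using w1[OF that] W by simp
  have "emeasure \<rho> (space \<rho>) = (\<integral>\<^sup>+x. ennreal (w x / W) * indicator (space leb_II) x \<partial>leb_II)"
    unfolding \<rho>_def by (simp only: space_density) (rule emeasure_density; measurable)
  also have "\<dots> = (\<integral>\<^sup>+x. ennreal (w x / W) \<partial>leb_II)"
    by (intro nn_integral_cong) simp
  also have "\<dots> = ennreal (expectation (\<lambda>x. w x / W))"
    using intw pos by (intro nn_integral_eq_integral AE_I2) auto
  also have "\<dots> = 1" using W by (simp add: W_def)
  finally have "prob_space \<rho>" by (rule prob_spaceI)
  moreover have sets_\<rho>: "sets \<rho> = sets borel_II" by (simp add: \<rho>_def sets_leb_II)
  moreover have "absolutely_continuous leb_II \<rho>"
    unfolding \<rho>_def by (rule absolutely_continuousI_density) measurable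
  ultimately have "(\<lambda>n. \<integral>x. f x \<partial>distr \<rho> borel_II (g ^^ n)) \<longlonglongrightarrow> (\<integral>x. f x \<partial>\<nu>)"
    using SNM f unfolding SNM_def weak_star_conv_def by blast
  moreover have "(\<integral>x. f x \<partial>distr \<rho> borel_II (g ^^ n)) = expectation (\<lambda>x. w x * f ((g ^^ n) x)) / W" for n
  proof -
    have "g ^^ n \<in> \<rho> \<rightarrow>\<^sub>M borel_II"
      using gn_II unfolding measurable_cong_sets[OF sets_\<rho> refl] .
    then have "(\<integral>x. f x \<partial>distr \<rho> borel_II (g ^^ n)) = (\<integral>x. f ((g ^^ n) x) \<partial>\<rho>)"
      by (rule integral_distr) (rule fm)
    also have "\<dots> = expectation (\<lambda>x. w x / W * f ((g ^^ n) x))"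
      unfolding \<rho>_def using pos by (intro integral_real_density AE_I2) auto
    also have "\<dots> = expectation (\<lambda>x. w x * f ((g ^^ n) x)) / W" by simp
    finally show ?thesis .
  qed
  ultimately have "(\<lambda>n. expectation (\<lambda>x. w x * f ((g ^^ n) x)) / W) \<longlonglongrightarrow> (\<integral>x. f x \<partial>\<nu>)"
    by simp
  \<comment> \<open>Multiplication by \<open>W\<close> undoes the normalization, and subtracting the
    constant centres the integrand.\<close>
  then have "(\<lambda>n. expectation (\<lambda>x. w x * f ((g ^^ n) x)) / W * W - W * (\<integral>x. f x \<partial>\<nu>))
      \<longlonglongrightarrow> (\<integral>x. f x \<partial>\<nu>) * W - W * (\<integral>x. f x \<partial>\<nu>)"
    by (intro tendsto_diff tendsto_mult tendsto_const)
  then show ?lim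
    using W intwF intw' by (simp add: right_diff_distrib W_def)
qed

text \<open>Write \<open>h\<close> as the difference of \<open>h + C\<close> and \<open>C\<close>, both multiples of probability densities.\<close>

lemma SNM_decorrelation:
  fixes f h :: "real \<Rightarrow> real"
  assumes SNM: "SNM g \<nu>" and g: "g \<in> borel_II \<rightarrow>\<^sub>M borel_II" and f: "continuous_on II f"
    and h [measurable]: "h \<in> borel_measurable leb_II" and hB: "\<And>x. x \<in> II \<Longrightarrow> \<bar>h x\<bar> \<le> B"
  shows "(\<lambda>n. \<integral>x. h x * (f ((g ^^ n) x) - (\<integral>x. f x \<partial>\<nu>)) \<partial>leb_II) \<longlonglongrightarrow> 0"
proof -
  \<comment> \<open>The additional 1 makes both weights \<open>h + C\<close> and \<open>C\<close> at
    least 1, as \<open>SNM_weighted\<close> demands.\<close>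
  define C where "C = \<bar>B\<bar> + 1"
  have h1: "1 \<le> h x + C" "h x + C \<le> 2 * C" if "x \<in> II" for x
    using hB[OF that] by (auto simp: C_def)
  have hC: "(\<lambda>x. h x + C) \<in> borel_measurable leb_II" "(\<lambda>x. C) \<in> borel_measurable leb_II"
    by measurable
  have C: "1 \<le> C" "C \<le> C" by (simp_all add: C_def)
  note shifted = SNM_weighted[OF SNM g f hC(1) h1]
  note unshifted = SNM_weighted[OF SNM g f hC(2) C]
  let ?F = "\<lambda>n x. f ((g ^^ n) x) - (\<integral>x. f x \<partial>\<nu>)"
  have "(\<integral>x. h x * ?F n x \<partial>leb_II) = (\<integral>x. (h x + C) * ?F n x \<partial>leb_II) - (\<integral>x. C * ?F n x \<partial>leb_II)" for n
  proof -
    have "(\<integral>x. h x * ?F n x \<partial>leb_II) = (\<integral>x. (h x + C) * ?F n x - C * ?F n x \<partial>leb_II)"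
      by (simp add: algebra_simps)
    also have "\<dots> = (\<integral>x. (h x + C) * ?F n x \<partial>leb_II) - (\<integral>x. C * ?F n x \<partial>leb_II)"
      by (rule Bochner_Integration.integral_diff[OF shifted(1) unshifted(1)])
    finally show ?thesis .
  qed
  then show ?thesis
    using tendsto_diff[OF shifted(2) unshifted(2)] by simp
qed

section \<open>Empirical measures and conclusion\<close>

text \<open>There are \<open>n\<close> atoms of mass \<open>1 / n\<close>; for \<open>n = 0\<close>
  the sum is empty and the measure is zero, so that index is excluded.\<close>

lemma prob_space_empirical:
  assumes "\<And>k. (g ^^ a k) x \<in> II" "n \<noteq> 0"
  shows "prob_space (empirical g a x n)"
proof -
  let ?P = "point_measure {..<n} (\<lambda>_. ennreal (1 / real n))"
  have "emeasure ?P (space ?P) = (\<Sum>k<n. ennreal (1 / real n))"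
    by (simp only: space_point_measure) (rule emeasure_point_measure_finite; simp)
  also have "\<dots> = ennreal (\<Sum>k<n. 1 / real n)"
    by (rule sum_ennreal) simp
  also have "\<dots> = 1" using assms(2) by simp
  finally have "prob_space ?P" by (rule prob_spaceI)
  then show ?thesis
    unfolding empirical_def dirac_sum_def using assms(1)
    by (intro prob_space.prob_space_distr) (simp_all add: measurable_point_measure_eq1 space_borel_II)
qed

lemma sets_empirical: "sets (empirical g a x n) = sets borel_II"
  by (simp add: empirical_def dirac_sum_def)

theorem theorem5p3:
  fixes g :: "real \<Rightarrow> real" and \<beta> :: real and b :: "nat \<Rightarrow> nat"
  assumes "g \<in> F_star \<beta>"
    and "SNM g (nu_star (1 / \<beta>) g)"
  shows "\<exists>a :: nat \<Rightarrow> nat. strict_mono a \<and> (\<forall>k. a k \<ge> b k) \<and>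
           (AE x in leb_II. weak_star_conv (\<lambda>n. empirical g a x n) (nu_star (1 / \<beta>) g))"
proof -
  define \<nu> where "\<nu> = nu_star (1 / \<beta>) g"
  have SNM: "SNM g \<nu>" using assms(2) by (simp add: \<nu>_def)
  have g: "g \<in> borel_II \<rightarrow>\<^sub>M borel_II"
    using assms(1) by (intro measurable_cond_A0) (simp add: F_star_def)
  interpret prob_space leb_II by (rule prob_space_leb_II)
  have [simp]: "space leb_II = II"
    using sets_eq_imp_space_eq[OF sets_leb_II] space_borel_II by simp
  have gn [measurable]: "g ^^ n \<in> leb_II \<rightarrow>\<^sub>M borel_II" for n
    using measurable_funpow[OF g] unfolding measurable_cong_sets[OF sets_leb_II refl] .
  have gn_II: "(g ^^ n) x \<in> II" if "x \<in> II" for n x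
    using measurable_space[OF gn, of x n] that by (simp add: space_borel_II)
  \<comment> \<open>The pushforwards of Lebesgue measure itself: SNM with constant density 1 gives
    their convergence to \<open>\<nu>\<close>, and they serve as the comparison measures.\<close>
  define N where "N n = distr leb_II borel_II (g ^^ n)" for n
  have N: "prob_space (N n)" "sets (N n) = sets borel_II" for n
    unfolding N_def by (auto intro: prob_space_distr gn)
  have N_lim: "(\<lambda>n. \<integral>x. f x \<partial>N n) \<longlonglongrightarrow> (\<integral>x. f x \<partial>\<nu>)" if "continuous_on II f" for f :: "real \<Rightarrow> real"
  proof -
    have "absolutely_continuous leb_II leb_II" by (simp add: absolutely_continuous_def)
    then have "weak_star_conv N \<nu>"
      using SNM prob_space_leb_II sets_leb_II unfolding SNM_def N_def[abs_def] by blast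
    then show ?thesis using that by (simp add: weak_star_conv_def)
  qed
  define c where "c j = (\<integral>x. x ^ j \<partial>\<nu>)" for j :: nat
  have pow_cont: "continuous_on II (\<lambda>x::real. x ^ j)" for j by (intro continuous_intros)
  have pow_le: "\<bar>x ^ j\<bar> \<le> 1" if "x \<in> II" for x :: real and j
    using that by (auto simp: power_abs intro!: power_le_one)
  \<comment> \<open>The bound on the moments of \<open>\<nu>\<close> is inherited in the limit from
    the probability measures \<open>N n\<close>, by comparing \<open>x ^ j\<close> with the zero
    function.\<close>
  have c1: "\<bar>c j\<bar> \<le> 1" for j
  proof (rule tendsto_upperbound)
    show "(\<lambda>n. \<bar>\<integral>x. x ^ j \<partial>N n\<bar>) \<longlonglongrightarrow> \<bar>c j\<bar>"
      unfolding c_def by (intro tendsto_rabs N_lim pow_cont)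
    have "\<bar>\<integral>x. x ^ j \<partial>N n\<bar> \<le> 1" for n
      using integral_diff_le_II[OF N pow_cont continuous_on_const, of j 0 1 n] pow_le by simp
    then show "\<forall>\<^sub>F n in sequentially. \<bar>\<integral>x. x ^ j \<partial>N n\<bar> \<le> 1" by simp
  qed simp
  define X where "X j n x = ((g ^^ n) x) ^ j - c j" for j n x
  have id_meas: "(\<lambda>x. x) \<in> borel_II \<rightarrow>\<^sub>M (borel :: real measure)"
    unfolding borel_II_def by (intro measurable_restrict_space1) simp
  have gn_borel [measurable]: "g ^^ n \<in> borel_measurable leb_II" for n
    using measurable_compose[OF gn id_meas] by simp
  have X_meas: "X j n \<in> borel_measurable leb_II" for j n
    unfolding X_def by measurable
  \<comment> \<open>The common bound 2 is 1 for the power plus 1 for \<open>c j\<close>.\<close>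
  have X_le: "\<bar>X j n x\<bar> \<le> 2" if "x \<in> space leb_II" for j n x
    using pow_le[OF gn_II, of x n j] c1[of j] that unfolding X_def by simp
  have X_null: "(\<lambda>n. expectation (\<lambda>x. h x * X j n x)) \<longlonglongrightarrow> 0"
    if "h \<in> borel_measurable leb_II" "\<And>x. x \<in> space leb_II \<Longrightarrow> \<bar>h x\<bar> \<le> 2" for j h
    using SNM_decorrelation[OF SNM g pow_cont that(1), of 2 j] that(2)
    by (simp add: X_def c_def)
  obtain a where a: "strict_mono a" "\<And>k. b k \<le> a k"
    and ae: "AE x in leb_II. \<forall>j. (\<lambda>n. (\<Sum>k<n. X j (a k) x) / real n) \<longlonglongrightarrow> 0"
    by (rule sparse_Cesaro_of_weak_null[of X 2 b, OF X_meas X_le _ X_null]) auto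
  have "AE x in leb_II. weak_star_conv (\<lambda>n. empirical g a x n) \<nu>"
    using AE_space ae
  proof eventually_elim
    fix x assume "x \<in> space leb_II" and lim: "\<forall>j. (\<lambda>n. (\<Sum>k<n. X j (a k) x) / real n) \<longlonglongrightarrow> 0"
    then have orb: "(g ^^ a k) x \<in> II" for k using gn_II by simp
    \<comment> \<open>The index is shifted to \<open>Suc n\<close> to avoid the zero measure at
      \<open>n = 0\<close>. The empirical moment is the average of the \<open>X j (a k) x\<close>
      plus \<open>c j\<close>, and both moments tend to \<open>c j\<close>.\<close>
    have mom: "(\<lambda>n. (\<integral>y. y ^ j \<partial>empirical g a x (Suc n)) - (\<integral>y. y ^ j \<partial>N n)) \<longlonglongrightarrow> 0" for j
    proof -
      have "(\<integral>y. y ^ j \<partial>empirical g a x (Suc n)) = (\<Sum>k<Suc n. X j (a k) x) / real (Suc n) + c j" for n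
      proof -
        have "(\<integral>y. y ^ j \<partial>empirical g a x (Suc n)) = (\<Sum>k<Suc n. 1 / real (Suc n) * ((g ^^ a k) x) ^ j)"
          unfolding empirical_def by (rule integral_dirac_sum) (use orb pow_cont in auto)
        also have "\<dots> = (\<Sum>k<Suc n. X j (a k) x + c j) / real (Suc n)"
          by (simp only: X_def diff_add_cancel sum_divide_distrib) simp
        also have "\<dots> = (\<Sum>k<Suc n. X j (a k) x) / real (Suc n) + c j"
          by (simp only: sum.distrib add_divide_distrib) (simp del: sum.lessThan_Suc of_nat_Suc)
        finally show ?thesis .
      qed
      moreover have "(\<lambda>n. (\<Sum>k<Suc n. X j (a k) x) / real (Suc n) + c j - (\<integral>y. y ^ j \<partial>N n)) \<longlonglongrightarrow> 0 + c j - c j"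
        unfolding c_def using lim
        by (intro tendsto_diff tendsto_add tendsto_const N_lim pow_cont LIMSEQ_Suc[of "\<lambda>n. (\<Sum>k<n. X j (a k) x) / real n"]) auto
      ultimately show ?thesis by simp
    qed
    show "weak_star_conv (\<lambda>n. empirical g a x n) \<nu>"
      unfolding weak_star_conv_def
    proof (intro allI impI)
      \<comment> \<open>Here \<open>f\<close> is arbitrary after \<open>x\<close> has been fixed:
        the exceptional null set depends only on the countably many moments and so serves every
        \<open>f\<close>.\<close>
      fix f :: "real \<Rightarrow> real" assume f: "continuous_on II f"
      have "(\<lambda>n. (\<integral>y. f y \<partial>empirical g a x (Suc n)) - (\<integral>y. f y \<partial>N n)) \<longlonglongrightarrow> 0"
        by (rule weak_star_diff_of_moments[OF _ sets_empirical N mom f])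
          (rule prob_space_empirical[OF orb], simp)
      \<comment> \<open>Adding back the integrals against \<open>N n\<close> replaces the comparison
        measures by their limit \<open>\<nu>\<close>.\<close>
      from tendsto_add[OF this N_lim[OF f]]
      have "(\<lambda>n. \<integral>y. f y \<partial>empirical g a x (Suc n)) \<longlonglongrightarrow> (\<integral>y. f y \<partial>\<nu>)" by simp
      then show "(\<lambda>n. \<integral>y. f y \<partial>empirical g a x n) \<longlonglongrightarrow> (\<integral>y. f y \<partial>\<nu>)"
        by (rule LIMSEQ_imp_Suc)
    qed
  qed
  then show ?thesis using a by (auto simp: \<nu>_def)
qed

end
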